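(* Let $\mathbf{x}=(x_1,\dots,x_k)$ be a vector of positive integers and let $r=\sum_{i=1}^k x_i$. For all $n\geq r$ we have \[ m(\mathbf{x},n)\leq\binom{n-k}{r-k}=\left(\frac{1}{(r-k)!}+o(1)\right)n^{r-k}, \] where $o(1)$ denotes a quantity tending to $0$ as $n\to\infty$ with $\mathbf{x}$ fixed.
   Context: $[n]=\{1,\dots,n\}$ and $[n]^{(r)}$ is the family of all $r$-element subsets of $[n]$. A Hamilton cycle in $K_n$ (on vertex set $[n]$) is regarded as a cyclic ordering $c_1,c_2,\dots,c_n$ of $[n]$, with indices taken modulo $n$. For $\mathbf{x}=(x_1,\dots,x_k)$ a vector of positive integers with $\sum_i x_i=r$ and a family $\mathcal{F}\subseteq[n]^{(r)}$, a Hamilton cycle $c_1,\dots,c_n$ is called $\mathbf{x}$-acceptable for (or with respect to) $\mathcal{F}$ if there do not exist $t_1,\dots,t_k$ with $\bigcup_{i=1}^k\{c_{t_i+1},c_{t_i+2},\dots,c_{t_i+x_i}\}\in\mathcal{F}$. Then $m(\mathbf{x},n)$ (for $n\ge r$) denotes the minimum of $|\mathcal{F}|$ over all families $\mathcal{F}\subseteq[n]^{(r)}$ such that $K_n$ does not contain an $\mathbf{x}$-acceptable Hamilton cycle with respect to $\mathcal{F}$. *)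

theory Defs
  imports Complex_Main "HOL-Library.Ramsey"
begin

(* A cyclic ordering c_1, ..., c_n of {1..n} with indices modulo n is an n-periodic function on the
   integers.  Rotations and reflections of c describe the same cycle; they are not identified, since
   every notion below is invariant under them. *)
definition hamilton_cycle :: "nat \<Rightarrow> (int \<Rightarrow> nat) \<Rightarrow> bool" where
  "hamilton_cycle n c \<longleftrightarrow>
     bij_betw c {1..int n} {1..n} \<and> (\<forall>i. c (i + int n) = c i)"

definition arc :: "(int \<Rightarrow> nat) \<Rightarrow> int \<Rightarrow> nat \<Rightarrow> nat set" where
  "arc c t l = c ` {t + 1..t + int l}"

(* Disjointness of the arcs is not required here: for a family of (sum_list xs)-element sets,
   membership of the union forces it. *)
definition acceptable :: "nat list \<Rightarrow> nat set set \<Rightarrow> (int \<Rightarrow> nat) \<Rightarrow> bool" where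
  "acceptable xs \<F> c \<longleftrightarrow>
     \<not> (\<exists>t :: nat \<Rightarrow> int. (\<Union>i<length xs. arc c (t i) (xs ! i)) \<in> \<F>)"

definition blocking :: "nat list \<Rightarrow> nat \<Rightarrow> nat set set \<Rightarrow> bool" where
  "blocking xs n \<F> \<longleftrightarrow>
     \<F> \<subseteq> nsets {1..n} (sum_list xs) \<and>
     \<not> (\<exists>c. hamilton_cycle n c \<and> acceptable xs \<F> c)"

(* For n \<ge> sum_list xs the family of all (sum_list xs)-element subsets is blocking (take consecutive
   arcs), so the minimum is over a nonempty finite set. *)
definition m :: "nat list \<Rightarrow> nat \<Rightarrow> nat" where
  "m xs n = Min (card ` {\<F>. blocking xs n \<F>})"

end

theory Submission
  imports Defs
begin

text \<open>
  Let \<open>\<F>\<close> consist of the \<open>r\<close>-element subsets of \<open>{1..n}\<close> that contain \<open>{1..k}\<close>; there are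
  \<open>(n - k) choose (r - k)\<close> of them. It is to be shown that \<open>\<F>\<close> is blocking, that is, that in every
  cyclic ordering any \<open>k\<close> points are covered by pairwise disjoint arcs of lengths
  \<open>x\<^sub>1, \<dots>, x\<^sub>k\<close> (\<open>ex_arcs_covering\<close>).

  Disjoint arcs come from a queueing argument (\<open>cyclic_queue\<close>). Regard the \<open>n\<close>-cycle as
  periodic discrete time and the \<open>k\<close> points as the arrival times of \<open>k\<close> customers, the \<open>i\<close>-th of
  whom needs the only server for \<open>x\<^sub>i\<close> time units. Since the total work \<open>r\<close> per period is at most
  \<open>n\<close>, there is a periodic first-come-first-served schedule, and the service intervals are the
  arcs. They are disjoint, and each arrival time is covered: either the server is busy at
  that time, or the arriving customer is served at once.

  The asymptotic formula holds because \<open>(n - k) choose d\<close> is \<open>1 / fact d\<close> times a product of \<open>d\<close>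
  factors \<open>n - k - i\<close>, each of which is asymptotic to \<open>n\<close>.
\<close>

section \<open>A periodic queue\<close>

lemma shift_periodic_mult:
  fixes f :: "int \<Rightarrow> int"
  assumes "\<And>i. f (i + k) = f i + q"
  shows "f (i + k * l) = f i + q * l"
proof (induction l rule: int_induct [where k = 0])
  case base
  then show ?case by simp
next
  case (step1 l)
  then show ?case using assms [of "i + k * l"] by (simp add: algebra_simps)
next
  case (step2 l)
  then show ?case using assms [of "i + k * (l - 1)"] by (simp add: algebra_simps)
qed

text \<open>
  Customer \<open>i\<close> arrives at time \<open>s i\<close> and needs \<open>x i\<close> time units, and \<open>X\<close> is a partial-sum function
  of \<open>x\<close>. Under first-come-first-served, the service of \<open>i\<close> starts at the maximum of
  \<open>s j + (X i - X j)\<close> over \<open>j \<le> i\<close>. The function \<open>s - X\<close> does not decrease under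
  shifts by a full period, so the last \<open>k\<close> indices suffice for the maximum.
\<close>
lemma cyclic_queue:
  fixes s x X :: "int \<Rightarrow> int" and k n r :: int
  assumes k: "k > 0" and n: "n > 0" and rn: "r \<le> n"
    and mono: "\<And>i j. i \<le> j \<Longrightarrow> s i \<le> s j" and s_shift: "\<And>i. s (i + k) = s i + n"
    and X_step: "\<And>i. X (i + 1) = X i + x i" and X_shift: "\<And>i. X (i + k) = X i + r"
    and x_pos: "\<And>i. x i > 0"
  obtains t where "\<And>i. t i + x i \<le> t (i + 1)"
    and "\<And>i. t (i + k) = t i + n"
    and "\<And>i. \<exists>j. t j \<le> s i \<and> s i < t j + x j"
proof -
  define u where "u i = s i - X i" for i
  define M where "M i = Max (u ` {i - k<..i})" for i
  define t where "t i = X i + M i" for i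
  have u_shift: "u (i + k) = u i + (n - r)" for i
    by (simp add: u_def s_shift X_shift)
  have M_step: "M (i + 1) = max (M i) (u (i + 1))" for i
  proof -
    have "{i + 1 - k<..i + 1} = insert (i + 1) {i + 1 - k<..i}"
      and "{i - k<..i} = insert (i + 1 - k) {i + 1 - k<..i}"
      using k by auto
    \<comment> \<open>The index that leaves the window is dominated by the one that enters.\<close>
    moreover have "u (i + 1 - k) \<le> u (i + 1)"
      using u_shift [of "i + 1 - k"] rn by simp
    ultimately show ?thesis
      by (cases "{i + 1 - k<..i} = {}") (simp_all add: M_def max.commute max.left_commute)
  qed
  have M_shift: "M (i + k) = M i + (n - r)" for i
  proof -
    have "{i + k - k<..i + k} = (\<lambda>j. j + k) ` {i - k<..i}"
    proof (intro equalityI subsetI)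
      fix y assume "y \<in> {i + k - k<..i + k}"
      then show "y \<in> (\<lambda>j. j + k) ` {i - k<..i}"
        by (intro image_eqI [of _ _ "y - k"]) auto
    qed auto
    then have "u ` {i + k - k<..i + k} = (\<lambda>y. y + (n - r)) ` u ` {i - k<..i}"
      by (simp add: image_image u_shift)
    moreover have "Max ((\<lambda>y. y + (n - r)) ` u ` {i - k<..i}) = M i + (n - r)"
      unfolding M_def
      by (rule mono_Max_commute [symmetric]) (use k in \<open>auto intro: monoI\<close>)
    ultimately show ?thesis by (simp add: M_def)
  qed
  have t_step: "t (i + 1) = max (t i + x i) (s (i + 1))" for i
    by (simp add: t_def M_step X_step u_def max_def)
  have t_shift: "t (i + k) = t i + n" for i
    by (simp add: t_def M_shift X_shift)
  have "\<exists>j. t j \<le> s i \<and> s i < t j + x j" for i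
  proof (rule ccontr)
    assume "\<nexists>j. t j \<le> s i \<and> s i < t j + x j"
    then have uncovered: "t j \<le> s i \<Longrightarrow> t j + x j \<le> s i" for j
      by (meson not_le)
    \<comment> \<open>A service not over by time \<open>s i\<close> starts after \<open>s i\<close>. Going backwards from \<open>i\<close>, every
      service would then start after \<open>s i\<close>, because no customer before \<open>i\<close> arrives after \<open>s i\<close>.\<close>
    have late: "j \<le> i \<Longrightarrow> s i < t j" for j
    proof (induction j rule: int_le_induct)
      case base
      have "t i \<ge> s i"
        using t_step [of "i - 1"] by simp
      then show ?case
        using uncovered [of i] x_pos [of i] by linarith
    next
      case (step j)
      have "s j \<le> s i"
        using mono step.hyps by simp
      then show ?case
        using step.IH t_step [of "j - 1"] uncovered [of "j - 1"] by simp linarith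
    qed
    \<comment> \<open>Going back \<open>l\<close> periods moves the start of service from \<open>t i\<close> to \<open>t i - n * l \<le> s i\<close>.\<close>
    define l where "l = \<bar>t i - s i\<bar>"
    have "t (i + k * (- l)) = t i + n * (- l)"
      by (rule shift_periodic_mult) (rule t_shift)
    moreover have "n * l \<ge> l" "k * l \<ge> 0"
      using n k by (auto simp: l_def mult_le_cancel_right1)
    ultimately show False
      using late [of "i + k * (- l)"] by (simp add: l_def)
  qed
  then show ?thesis
    using that [of t] t_step t_shift by simp
qed

section \<open>Periodic extension of lists\<close>

text \<open>
  The extension of a list to all integer indices under which a shift of the index by the length of
  the list adds \<open>q\<close> to the value.
\<close>
definition periodic_extension :: "int \<Rightarrow> int list \<Rightarrow> int \<Rightarrow> int" where
  "periodic_extension q ys i =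
     q * (i div int (length ys)) + ys ! nat (i mod int (length ys))"

lemma periodic_extension_shift:
  assumes "ys \<noteq> []"
  shows "periodic_extension q ys (i + int (length ys)) = periodic_extension q ys i + q"
  using assms by (simp add: periodic_extension_def algebra_simps)

lemma periodic_extension_of_nat:
  "i < length ys \<Longrightarrow> periodic_extension q ys (int i) = ys ! i"
  by (simp add: periodic_extension_def flip: zdiv_int zmod_int)

lemma div_mod_succ_cases:
  fixes i k :: int
  assumes "k > 0"
  obtains "i mod k + 1 < k" "(i + 1) div k = i div k" "(i + 1) mod k = i mod k + 1"
  | "i mod k = k - 1" "(i + 1) div k = i div k + 1" "(i + 1) mod k = 0"
proof (cases "i mod k + 1 < k")
  case True
  have *: "i + 1 = k * (i div k) + (i mod k + 1)" "0 \<le> i mod k + 1"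
    using assms by simp_all
  have "(i + 1) div k = i div k" "(i + 1) mod k = i mod k + 1"
    using int_div_pos_eq [OF * True] int_mod_pos_eq [OF * True] by blast+
  then show ?thesis
    using that(1) True by blast
next
  case False
  moreover have "i mod k < k"
    using assms by simp
  ultimately have m: "i mod k = k - 1"
    by linarith
  have "i + 1 = k * (i div k) + (i mod k + 1)"
    by simp
  then have "i + 1 = k * (i div k + 1)"
    by (simp add: m distrib_left)
  then have "(i + 1) div k = i div k + 1" "(i + 1) mod k = 0"
    using assms by simp_all
  with m show ?thesis
    by (rule that(2))
qed

lemma periodic_extension_mono:
  assumes "sorted ys" and "ys \<noteq> []" and "last ys \<le> q + hd ys" and "i \<le> j"
  shows "periodic_extension q ys i \<le> periodic_extension q ys j"
  using \<open>i \<le> j\<close>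
proof (induction j rule: int_ge_induct)
  case base
  then show ?case by simp
next
  case (step j)
  have k: "0 < int (length ys)" using assms(2) by simp
  have "periodic_extension q ys j \<le> periodic_extension q ys (j + 1)"
  proof (cases rule: div_mod_succ_cases [OF k, of j])
    case 1
    have "nat (j mod int (length ys) + 1) < length ys"
      using 1(1) k pos_mod_sign [OF k, of j] by linarith
    then have "ys ! nat (j mod int (length ys)) \<le> ys ! nat (j mod int (length ys) + 1)"
      using assms(1) by (intro sorted_nth_mono) simp_all
    then show ?thesis
      using 1 by (simp add: periodic_extension_def)
  next
    case 2
    have "nat (j mod int (length ys)) = length ys - 1"
      using 2(1) by simp
    then show ?thesis
      using 2(2,3) assms(2,3) by (simp add: periodic_extension_def algebra_simps last_conv_nth hd_conv_nth)
  qed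
  then show ?case using step.IH by simp
qed

lemma periodic_extension_partial_sums:
  fixes xs :: "int list"
  assumes "xs \<noteq> []"
  defines "X \<equiv> periodic_extension (sum_list xs) (map (\<lambda>j. sum_list (take j xs)) [0..<length xs])"
  shows "X (i + 1) = X i + periodic_extension 0 xs i"
proof -
  have k: "0 < int (length xs)" using assms(1) by simp
  show ?thesis
  proof (cases rule: div_mod_succ_cases [OF k, of i])
    case 1
    then have lt: "Suc (nat (i mod int (length xs))) < length xs"
      using k pos_mod_sign [OF k, of i] by linarith
    have "nat (i mod int (length xs) + 1) = Suc (nat (i mod int (length xs)))"
      using k by (simp add: nat_add_distrib)
    then show ?thesis
      using 1 lt by (simp add: X_def periodic_extension_def take_Suc_conv_app_nth)
  next
    case 2
    have "nat (i mod int (length xs)) = length xs - 1"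
      using 2(1) by simp
    moreover have "sum_list xs = sum_list (take (length xs - 1) xs) + xs ! (length xs - 1)"
      using assms(1) by (cases xs rule: rev_cases) auto
    ultimately show ?thesis
      using 2(2,3) assms(1) by (simp add: X_def periodic_extension_def distrib_left)
  qed
qed

section \<open>Covering points of a Hamilton cycle by disjoint arcs\<close>

lemma hamilton_cycle_shift_mult:
  assumes "hamilton_cycle n c"
  shows "c (i + int n * l) = c i"
proof -
  have "int (c (i + int n * l)) = int (c i) + 0 * l"
    by (rule shift_periodic_mult) (use assms in \<open>simp add: hamilton_cycle_def\<close>)
  then show ?thesis by simp
qed

lemma hamilton_cycle_representative:
  assumes "hamilton_cycle n c" and "n > 0"
  shows "(i - 1) mod int n + 1 \<in> {1..int n}" and "c ((i - 1) mod int n + 1) = c i"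
proof -
  have "(i - 1) mod int n < int n"
    using assms(2) by simp
  then show "(i - 1) mod int n + 1 \<in> {1..int n}"
    using assms(2) by (simp add: add1_zle_eq)
  have "(i - 1) mod int n + 1 + int n * ((i - 1) div int n) = i"
    by (simp add: algebra_simps)
  then show "c ((i - 1) mod int n + 1) = c i"
    by (metis hamilton_cycle_shift_mult [OF assms(1)])
qed

lemma hamilton_cycle_in_range:
  assumes "hamilton_cycle n c" and "n > 0"
  shows "c i \<in> {1..n}"
  using hamilton_cycle_representative [OF assms, of i] assms(1)
  by (metis bij_betwE hamilton_cycle_def)

lemma hamilton_cycle_inj_on:
  assumes "hamilton_cycle n c" and "n > 0"
  shows "inj_on c {a..<a + int n}"
proof (rule inj_onI)
  fix i j assume ij: "i \<in> {a..<a + int n}" "j \<in> {a..<a + int n}" and "c i = c j"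
  then have "(i - 1) mod int n + 1 = (j - 1) mod int n + 1"
    using hamilton_cycle_representative [OF assms] assms(1)
    by (metis bij_betw_imp_inj_on hamilton_cycle_def inj_onD)
  then have "int n dvd i - j"
    by (simp add: mod_eq_dvd_iff)
  moreover have "\<bar>i - j\<bar> < int n"
    using ij by auto
  ultimately show "i = j"
    using dvd_imp_le_int [of "i - j" "int n"] by fastforce
qed

text \<open>
  That the union has \<open>sum_list xs\<close> elements says that the arcs are pairwise disjoint.
\<close>
lemma ex_arcs_covering:
  assumes c: "hamilton_cycle n c" and ne: "xs \<noteq> []" and pos: "\<forall>x\<in>set xs. x > 0"
    and le: "sum_list xs \<le> n" and S: "S \<subseteq> {1..n}" "card S = length xs"
  obtains t :: "nat \<Rightarrow> int"
  where "S \<subseteq> (\<Union>i<length xs. arc c (t i) (xs ! i))"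
    and "(\<Union>i<length xs. arc c (t i) (xs ! i)) \<in> nsets {1..n} (sum_list xs)"
proof -
  define k where "k = length xs"
  have k: "k > 0" using ne by (simp add: k_def)
  have "card S \<le> n"
    using card_mono [OF _ S(1)] by simp
  then have n: "n > 0"
    using S(2) k unfolding k_def by linarith
  \<comment> \<open>The positions of the points of \<open>S\<close> are the arrival times.\<close>
  define P where "P = {p \<in> {1..int n}. c p \<in> S}"
  have bij: "bij_betw c {1..int n} {1..n}"
    using c by (simp add: hamilton_cycle_def)
  have c_P: "c ` P = S"
  proof
    show "c ` P \<subseteq> S" by (auto simp: P_def)
    show "S \<subseteq> c ` P"
    proof
      fix y assume y: "y \<in> S"
      then have "y \<in> c ` {1..int n}"
        using S(1) bij by (auto simp: bij_betw_def)
      then show "y \<in> c ` P"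
        using y by (auto simp: P_def)
    qed
  qed
  have fin_P: "finite P"
    by (rule finite_subset [of _ "{1..int n}"]) (auto simp: P_def)
  have "inj_on c P"
    by (rule inj_on_subset [OF bij_betw_imp_inj_on [OF bij]]) (auto simp: P_def)
  then have card_P: "card P = k"
    using c_P S(2) card_image k_def by metis
  define ps where "ps = sorted_list_of_set P"
  have ps: "sorted ps" "set ps = P" "length ps = k"
    using fin_P card_P by (auto simp: ps_def)
  have ps_ne: "ps \<noteq> []" using ps(3) k by auto
  have "last ps \<in> {1..int n}" "hd ps \<in> {1..int n}"
    using last_in_set [OF ps_ne] hd_in_set [OF ps_ne] ps(2) by (simp_all add: P_def)
  then have last_hd: "last ps \<le> int n + hd ps" by auto
  define ys where "ys = map int xs"
  have ys: "ys \<noteq> []" "length ys = k" "sum_list ys = int (sum_list xs)"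
    using ne by (auto simp: ys_def k_def sum_list_of_nat)
  define s where "s = periodic_extension (int n) ps"
  define x where "x = periodic_extension 0 ys"
  define X where
    "X = periodic_extension (sum_list ys) (map (\<lambda>j. sum_list (take j ys)) [0..<length ys])"
  have x_pos: "x i > 0" for i
  proof -
    have "nat (i mod int k) < k"
      using k by (simp add: nat_less_iff)
    then show ?thesis
      using pos by (simp add: x_def periodic_extension_def ys_def k_def)
  qed
  have s_mono: "i \<le> j \<Longrightarrow> s i \<le> s j" for i j
    unfolding s_def using ps(1) ps_ne last_hd by (rule periodic_extension_mono)
  have s_shift: "s (i + int k) = s i + int n" for i
    using periodic_extension_shift [OF ps_ne] ps(3) by (simp add: s_def)
  have X_step: "X (i + 1) = X i + x i" for i
    unfolding X_def x_def using ys(1) by (rule periodic_extension_partial_sums)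
  have X_shift: "X (i + int k) = X i + int (sum_list xs)" for i
    using periodic_extension_shift [of "map (\<lambda>j. sum_list (take j ys)) [0..<length ys]"] ys k
    by (simp add: X_def)
  obtain t where t_step: "\<And>i. t i + x i \<le> t (i + 1)"
    and t_shift: "\<And>i. t (i + int k) = t i + int n"
    and covered: "\<And>i. \<exists>j. t j \<le> s i \<and> s i < t j + x j"
    by (rule cyclic_queue [of "int k" "int n" "int (sum_list xs)" s X x])
      (use k n le s_mono s_shift X_step X_shift x_pos in auto)
  have x_nat: "x (int i) = int (xs ! i)" if "i < k" for i
    using that by (simp add: x_def periodic_extension_of_nat ys ys_def k_def)
  define I where "I i = {t (int i)..<t (int i) + int (xs ! i)}" for i
  have arc_I: "arc c (t (int i) - 1) (xs ! i) = c ` I i" for i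
    unfolding arc_def I_def by (rule arg_cong [of _ _ "(`) c"]) auto
  define U where "U = (\<Union>i<k. I i)"
  have U_eq: "(\<Union>i<length xs. arc c (t (int i) - 1) (xs ! i)) = c ` U"
    by (auto simp: arc_I U_def k_def)
  have t_before: "i < j \<Longrightarrow> t i + x i \<le> t j" for i j
  proof (induction j rule: int_gr_induct)
    case base
    then show ?case by (rule t_step)
  next
    case (step j)
    then show ?case
      using t_step [of j] x_pos [of j] by linarith
  qed
  have I_disjoint: "I i \<inter> I j = {}" if "i < j" "j < k" for i j
    using t_before [of "int i" "int j"] x_nat [of i] that by (auto simp: I_def)
  have "card U = (\<Sum>i<k. card (I i))"
    unfolding U_def
  proof (rule card_UN_disjoint)
    show "\<forall>i\<in>{..<k}. \<forall>j\<in>{..<k}. i \<noteq> j \<longrightarrow> I i \<inter> I j = {}"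
      using I_disjoint by (metis Int_commute lessThan_iff nat_neq_iff)
  qed (auto simp: I_def)
  also have "\<dots> = sum_list xs"
    by (simp add: I_def sum_list_sum_nth k_def atLeast0LessThan)
  finally have card_U: "card U = sum_list xs" .
  have "U \<subseteq> {t 0..<t 0 + int n}"
  proof -
    have "I i \<subseteq> {t 0..<t 0 + int n}" if "i < k" for i
    proof -
      have "t 0 \<le> t (int i)"
        using t_before [of 0 "int i"] x_pos [of 0] by (cases "i = 0") auto
      moreover have "t (int i) + x (int i) \<le> t 0 + int n"
        using t_before [of "int i" "int k"] t_shift [of 0] that by simp
      ultimately show ?thesis
        using x_nat [OF that] by (auto simp: I_def)
    qed
    then show ?thesis by (auto simp: U_def)
  qed
  then have "inj_on c U"
    using hamilton_cycle_inj_on [OF c n] inj_on_subset by blast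
  then have "card (c ` U) = sum_list xs"
    by (simp add: card_image card_U)
  moreover have "c ` U \<subseteq> {1..n}"
    using hamilton_cycle_in_range [OF c n] by blast
  moreover have "finite U"
    by (simp add: U_def I_def)
  ultimately have 1: "c ` U \<in> nsets {1..n} (sum_list xs)"
    by (simp add: nsets_def)
  have 2: "S \<subseteq> c ` U"
  proof
    fix y assume "y \<in> S"
    then obtain p where p: "p \<in> P" "y = c p"
      using c_P by auto
    then obtain i where i: "i < k" "p = ps ! i"
      using ps by (metis in_set_conv_nth)
    then have "p = s (int i)"
      using ps(3) by (simp add: s_def periodic_extension_of_nat)
    then obtain j where j: "t j \<le> p" "p < t j + x j"
      using covered by blast
    \<comment> \<open>The arc that covers \<open>p\<close> is moved by a multiple of \<open>n\<close> to one with index in \<open>{0..<k}\<close>.\<close>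
    define l where "l = j div int k"
    define b where "b = nat (j mod int k)"
    have b: "b < k" "int b = j mod int k" "j = int b + int k * l"
      using k by (auto simp: b_def l_def nat_less_iff)
    have "t j = t (int b) + int n * l"
      unfolding b(3) by (rule shift_periodic_mult) (rule t_shift)
    moreover have "x j = x (int b)"
      using b by (simp add: x_def periodic_extension_def ys(2))
    ultimately have "p + int n * (- l) \<in> I b"
      using j x_nat [OF b(1)] by (simp add: I_def)
    then have "c (p + int n * (- l)) \<in> c ` U"
      using b(1) by (auto simp: U_def)
    then show "y \<in> c ` U"
      using p(2) hamilton_cycle_shift_mult [OF c] by metis
  qed
  show ?thesis
    using that [of "\<lambda>i. t (int i) - 1"] 1 2 by (simp add: U_eq)
qed

section \<open>The blocking family and its size\<close>

lemma m_le_card_blocking: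
  assumes "blocking xs n \<F>"
  shows "m xs n \<le> card \<F>"
proof -
  have "{\<F>. blocking xs n \<F>} \<subseteq> Pow (nsets {1..n} (sum_list xs))"
    by (auto simp: blocking_def)
  then have "finite {\<F>. blocking xs n \<F>}"
    by (rule finite_subset) (simp add: finite_imp_finite_nsets)
  then show ?thesis
    unfolding m_def using assms by (intro Min_le) auto
qed

lemma card_nsets_superset_le:
  assumes "S \<subseteq> A" and "finite A"
  shows "card {B \<in> nsets A r. S \<subseteq> B} \<le> (card A - card S) choose (r - card S)"
proof -
  have fin: "finite (A - S)" and "finite S"
    using assms finite_subset by auto
  have "{B \<in> nsets A r. S \<subseteq> B} \<subseteq> (\<union>) S ` nsets (A - S) (r - card S)"
  proof
    fix B assume B: "B \<in> {B \<in> nsets A r. S \<subseteq> B}"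
    then have "B - S \<in> nsets (A - S) (r - card S)"
      using \<open>finite S\<close> by (auto simp: nsets_def card_Diff_subset)
    moreover have "B = S \<union> (B - S)" using B by auto
    ultimately show "B \<in> (\<union>) S ` nsets (A - S) (r - card S)" by blast
  qed
  then have "card {B \<in> nsets A r. S \<subseteq> B} \<le> card (nsets (A - S) (r - card S))"
    using fin by (meson finite_imp_finite_nsets surj_card_le)
  also have "\<dots> = (card A - card S) choose (r - card S)"
    using assms \<open>finite S\<close> by (simp add: card_Diff_subset)
  finally show ?thesis .
qed

lemma m_le_choose:
  assumes "xs \<noteq> []" and pos: "\<forall>x\<in>set xs. x > 0" and le: "sum_list xs \<le> n"
  shows "m xs n \<le> (n - length xs) choose (sum_list xs - length xs)"
proof -
  define S where "S = {1..length xs}"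
  define \<F> where "\<F> = {B \<in> nsets {1..n} (sum_list xs). S \<subseteq> B}"
  have "length xs \<le> sum_list xs"
    using pos by (induction xs) (auto simp: Suc_le_eq)
  then have S: "S \<subseteq> {1..n}" "card S = length xs"
    using le by (auto simp: S_def)
  have "\<not> acceptable xs \<F> c" if "hamilton_cycle n c" for c
    using ex_arcs_covering [OF that assms S] unfolding acceptable_def \<F>_def by blast
  then have "blocking xs n \<F>"
    by (auto simp: blocking_def \<F>_def)
  then have "m xs n \<le> card \<F>"
    by (rule m_le_card_blocking)
  also have "\<dots> \<le> (n - length xs) choose (sum_list xs - length xs)"
    using card_nsets_superset_le [OF S(1), of "sum_list xs"] S(2) by (simp add: \<F>_def)
  finally show ?thesis .
qed

lemma choose_asymptotic:
  "(\<lambda>n. real ((n - k) choose d) / real n ^ d) \<longlonglongrightarrow> 1 / fact d"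
proof -
  have "(\<lambda>n. (real n - (real k + real i)) / real n) \<longlonglongrightarrow> 1" for i
  proof -
    have "(\<lambda>n. 1 - (real k + real i) / real n) \<longlonglongrightarrow> 1 - 0"
      by (intro tendsto_intros lim_const_over_n)
    moreover have "\<forall>\<^sub>F n in sequentially.
        1 - (real k + real i) / real n = (real n - (real k + real i)) / real n"
      using eventually_gt_at_top [of 0] by eventually_elim (simp add: diff_divide_distrib)
    ultimately show ?thesis
      by (simp add: filterlim_cong)
  qed
  then have "(\<lambda>n. (\<Prod>i = 0..<d. (real n - (real k + real i)) / real n) / fact d)
      \<longlonglongrightarrow> (\<Prod>i = 0..<d. 1) / fact d"
    by (intro tendsto_intros) auto
  moreover have "\<forall>\<^sub>F n in sequentially.
      (\<Prod>i = 0..<d. (real n - (real k + real i)) / real n) / fact d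
      = real ((n - k) choose d) / real n ^ d"
    using eventually_ge_at_top [of k]
  proof eventually_elim
    case (elim n)
    then have "real ((n - k) choose d) = (\<Prod>i = 0..<d. real n - (real k + real i)) / fact d"
      by (simp add: binomial_gbinomial gbinomial_prod_rev diff_diff_eq)
    then show ?case
      by (simp add: prod_dividef)
  qed
  ultimately show ?thesis
    by (simp add: filterlim_cong)
qed

theorem theorem15:
  fixes xs :: "nat list" and k r :: nat
  assumes "xs \<noteq> []" and "\<forall>x\<in>set xs. x > 0"
    and "k = length xs" and "r = sum_list xs"
  shows "(\<forall>n\<ge>r. m xs n \<le> (n - k) choose (r - k)) \<and>
    (\<exists>\<epsilon> :: nat \<Rightarrow> real. \<epsilon> \<longlonglongrightarrow> 0 \<and>
      (\<forall>n\<ge>r. real ((n - k) choose (r - k)) = (1 / fact (r - k) + \<epsilon> n) * real n ^ (r - k)))"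
proof (intro conjI exI)
  show "\<forall>n\<ge>r. m xs n \<le> (n - k) choose (r - k)"
    using m_le_choose assms by simp
  define \<epsilon> where
    "\<epsilon> n = real ((n - k) choose (r - k)) / real n ^ (r - k) - 1 / fact (r - k)" for n
  show "\<epsilon> \<longlonglongrightarrow> 0"
    unfolding \<epsilon>_def using choose_asymptotic by (simp add: LIM_zero)
  have "r > 0"
    using assms by (cases xs) auto
  then show "\<forall>n\<ge>r. real ((n - k) choose (r - k)) = (1 / fact (r - k) + \<epsilon> n) * real n ^ (r - k)"
    by (auto simp: \<epsilon>_def)
qed

end
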